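(* Let $Q$ be an automorphic loop and $x,y\in Q$. Then $x(xy)=(yx)x$ if and only if $x^2y=yx^2$.
   Context: A loop is a set with a binary operation in which all equations $ax=b$, $ya=b$ are uniquely solvable and which has a two-sided identity. For $a\in L$, $R_a:x\mapsto xa$, $L_a:x\mapsto ax$; the inner mapping group is the stabilizer of the identity in the group generated by all $R_a,L_a$. A loop is automorphic if every inner mapping is an automorphism. Automorphic loops are power associative, so $x^2=xx$ is unambiguous. *)

theory Defs
  imports Main
begin

definition loop :: "'a set \<Rightarrow> ('a \<Rightarrow> 'a \<Rightarrow> 'a) \<Rightarrow> 'a \<Rightarrow> bool" where
  "loop Q m e \<longleftrightarrow> e \<in> Q \<and> (\<forall>x\<in>Q. \<forall>y\<in>Q. m x y \<in> Q)
     \<and> (\<forall>x\<in>Q. m e x = x \<and> m x e = x)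
     \<and> (\<forall>a\<in>Q. \<forall>b\<in>Q. \<exists>!x. x \<in> Q \<and> m a x = b)
     \<and> (\<forall>a\<in>Q. \<forall>b\<in>Q. \<exists>!y. y \<in> Q \<and> m y a = b)"

definition Rmap :: "'a set \<Rightarrow> ('a \<Rightarrow> 'a \<Rightarrow> 'a) \<Rightarrow> 'a \<Rightarrow> 'a \<Rightarrow> 'a" where
  "Rmap Q m a = (\<lambda>x. if x \<in> Q then m x a else x)"
definition Lmap :: "'a set \<Rightarrow> ('a \<Rightarrow> 'a \<Rightarrow> 'a) \<Rightarrow> 'a \<Rightarrow> 'a \<Rightarrow> 'a" where
  "Lmap Q m a = (\<lambda>x. if x \<in> Q then m a x else x)"
definition Rinv :: "'a set \<Rightarrow> ('a \<Rightarrow> 'a \<Rightarrow> 'a) \<Rightarrow> 'a \<Rightarrow> 'a \<Rightarrow> 'a" where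
  "Rinv Q m a = (\<lambda>x. if x \<in> Q then (THE y. y \<in> Q \<and> m y a = x) else x)"
definition Linv :: "'a set \<Rightarrow> ('a \<Rightarrow> 'a \<Rightarrow> 'a) \<Rightarrow> 'a \<Rightarrow> 'a \<Rightarrow> 'a" where
  "Linv Q m a = (\<lambda>x. if x \<in> Q then (THE y. y \<in> Q \<and> m a y = x) else x)"

inductive_set mlt_group :: "'a set \<Rightarrow> ('a \<Rightarrow> 'a \<Rightarrow> 'a) \<Rightarrow> ('a \<Rightarrow> 'a) set"
  for Q m where
  mlt_id: "id \<in> mlt_group Q m"
| mlt_R: "f \<in> mlt_group Q m \<Longrightarrow> a \<in> Q \<Longrightarrow> Rmap Q m a \<circ> f \<in> mlt_group Q m"
| mlt_L: "f \<in> mlt_group Q m \<Longrightarrow> a \<in> Q \<Longrightarrow> Lmap Q m a \<circ> f \<in> mlt_group Q m"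
| mlt_Rinv: "f \<in> mlt_group Q m \<Longrightarrow> a \<in> Q \<Longrightarrow> Rinv Q m a \<circ> f \<in> mlt_group Q m"
| mlt_Linv: "f \<in> mlt_group Q m \<Longrightarrow> a \<in> Q \<Longrightarrow> Linv Q m a \<circ> f \<in> mlt_group Q m"

definition inn_group :: "'a set \<Rightarrow> ('a \<Rightarrow> 'a \<Rightarrow> 'a) \<Rightarrow> 'a \<Rightarrow> ('a \<Rightarrow> 'a) set" where
  "inn_group Q m e = {f \<in> mlt_group Q m. f e = e}"

definition loop_aut :: "'a set \<Rightarrow> ('a \<Rightarrow> 'a \<Rightarrow> 'a) \<Rightarrow> ('a \<Rightarrow> 'a) \<Rightarrow> bool" where
  "loop_aut Q m f \<longleftrightarrow> bij_betw f Q Q \<and> (\<forall>x\<in>Q. \<forall>y\<in>Q. f (m x y) = m (f x) (f y))"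

definition automorphic_loop :: "'a set \<Rightarrow> ('a \<Rightarrow> 'a \<Rightarrow> 'a) \<Rightarrow> 'a \<Rightarrow> bool" where
  "automorphic_loop Q m e \<longleftrightarrow> loop Q m e \<and> (\<forall>f\<in>inn_group Q m e. loop_aut Q m f)"

end

(* Write T_x y = x\(yx). Since T_x fixes x, x(xy) = (yx)x says T_x (T_x y) = y; since T_y is an
   automorphism, x^2 y = y x^2 says (T_y x)^2 = x^2. With c = y\(T_x y) one has
   T_y x = x c^-1 and c^-1 = (T_x y)\y, and (x c^-1)^2 = x (c\(x c^-1)) in every automorphic loop.
   Hence the second condition amounts to x c^-1 = c x = x (T_x c), that is, to
   (T_x y)\y = T_x c = (T_x y)\(T_x (T_x y)), which is the first condition. *)

theory Submission
  imports Defs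
begin

section \<open>Multiplication and left division\<close>

locale automorphic =
  fixes Q :: "'a set" and m :: "'a \<Rightarrow> 'a \<Rightarrow> 'a" (infixl "\<cdot>" 70) and e :: 'a
  assumes automorphic: "automorphic_loop Q m e"
begin

lemma loop: "loop Q m e"
  using automorphic by (simp add: automorphic_loop_def)

lemma e_in [simp]: "e \<in> Q"
  and mult_in [simp]: "\<lbrakk>x \<in> Q; y \<in> Q\<rbrakk> \<Longrightarrow> x \<cdot> y \<in> Q"
  and e_mult [simp]: "x \<in> Q \<Longrightarrow> e \<cdot> x = x"
  and mult_e [simp]: "x \<in> Q \<Longrightarrow> x \<cdot> e = x"
  using loop by (simp_all add: loop_def)

lemma mult_right_cancel [simp]:
  assumes "x \<in> Q" "y \<in> Q" "z \<in> Q"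
  shows "y \<cdot> x = z \<cdot> x \<longleftrightarrow> y = z"
proof -
  have "\<exists>!w. w \<in> Q \<and> w \<cdot> x = z \<cdot> x"
    using loop assms by (simp add: loop_def)
  with assms show ?thesis by blast
qed

definition ldiv :: "'a \<Rightarrow> 'a \<Rightarrow> 'a" (infixl "\<bbslash>" 70) where
  "x \<bbslash> y = (THE z. z \<in> Q \<and> x \<cdot> z = y)"

lemma ldiv_unique_ex:
  "\<lbrakk>x \<in> Q; y \<in> Q\<rbrakk> \<Longrightarrow> \<exists>!z. z \<in> Q \<and> x \<cdot> z = y"
  using loop by (simp add: loop_def)

lemma ldiv_in [simp]: "\<lbrakk>x \<in> Q; y \<in> Q\<rbrakk> \<Longrightarrow> x \<bbslash> y \<in> Q"
  and mult_ldiv [simp]: "\<lbrakk>x \<in> Q; y \<in> Q\<rbrakk> \<Longrightarrow> x \<cdot> (x \<bbslash> y) = y"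
  using theI'[OF ldiv_unique_ex] by (auto simp: ldiv_def)

lemma mult_left_cancel [simp]:
  "\<lbrakk>x \<in> Q; y \<in> Q; z \<in> Q\<rbrakk> \<Longrightarrow> x \<cdot> y = x \<cdot> z \<longleftrightarrow> y = z"
  using ldiv_unique_ex[of x "x \<cdot> z"] by auto

lemma ldiv_eq_iff: "\<lbrakk>x \<in> Q; y \<in> Q; z \<in> Q\<rbrakk> \<Longrightarrow> x \<bbslash> y = z \<longleftrightarrow> y = x \<cdot> z"
  by (metis ldiv_in mult_ldiv mult_left_cancel)

lemma ldiv_mult [simp]: "\<lbrakk>x \<in> Q; y \<in> Q\<rbrakk> \<Longrightarrow> x \<bbslash> (x \<cdot> y) = y"
  by (simp add: ldiv_eq_iff)

lemma ldiv_left_cancel [simp]: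
  "\<lbrakk>x \<in> Q; y \<in> Q; z \<in> Q\<rbrakk> \<Longrightarrow> x \<bbslash> y = x \<bbslash> z \<longleftrightarrow> y = z"
  by (metis mult_ldiv)

lemma e_ldiv [simp]: "x \<in> Q \<Longrightarrow> e \<bbslash> x = x"
  by (simp add: ldiv_eq_iff)

section \<open>Inner mappings as endomorphisms\<close>

definition hom :: "('a \<Rightarrow> 'a) \<Rightarrow> bool" where
  "hom \<phi> \<longleftrightarrow> \<phi> ` Q \<subseteq> Q \<and> (\<forall>x\<in>Q. \<forall>y\<in>Q. \<phi> (x \<cdot> y) = \<phi> x \<cdot> \<phi> y)"

context
  fixes \<phi> assumes hom: "hom \<phi>"
begin

lemma hom_in: "x \<in> Q \<Longrightarrow> \<phi> x \<in> Q"
  and hom_mult: "\<lbrakk>x \<in> Q; y \<in> Q\<rbrakk> \<Longrightarrow> \<phi> (x \<cdot> y) = \<phi> x \<cdot> \<phi> y"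
  using hom by (auto simp: hom_def)

lemma hom_ldiv: "\<lbrakk>x \<in> Q; y \<in> Q\<rbrakk> \<Longrightarrow> \<phi> (x \<bbslash> y) = \<phi> x \<bbslash> \<phi> y"
  by (metis hom_in hom_mult ldiv_in mult_ldiv ldiv_mult)

lemma hom_e: "\<phi> e = e"
  using hom_mult[of e e] mult_left_cancel[of "\<phi> e" "\<phi> e" e] by (simp add: hom_in)

end

text \<open>Members of \<open>mlt_group\<close> are the identity outside \<open>Q\<close>, while
  \<open>T\<close> and \<open>F\<close> below are given by one formula on the whole type; hence
  agreement is asked on \<open>Q\<close> only.\<close>

lemma inner_hom:
  assumes "f \<in> mlt_group Q m" "f e = e" "\<And>x. x \<in> Q \<Longrightarrow> \<phi> x = f x"
  shows "hom \<phi>"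
proof -
  have "loop_aut Q m f"
    using automorphic assms by (simp add: automorphic_loop_def inn_group_def)
  then show ?thesis
    using assms(3) by (auto simp: loop_aut_def hom_def bij_betw_def)
qed

definition T :: "'a \<Rightarrow> 'a \<Rightarrow> 'a" where
  "T x y = x \<bbslash> (y \<cdot> x)"

lemma T_hom:
  assumes "x \<in> Q"
  shows "hom (T x)"
proof (rule inner_hom)
  show "Linv Q m x \<circ> (Rmap Q m x \<circ> id) \<in> mlt_group Q m"
    using assms by (intro mlt_group.intros)
qed (use assms in \<open>auto simp: Linv_def Rmap_def T_def ldiv_eq_iff simp flip: ldiv_def\<close>)

text \<open>The left inner mapping: left multiplication by \<open>y\<close>, then by
  \<open>x\<close>, then the inverse of left multiplication by their product.\<close>

definition F :: "'a \<Rightarrow> 'a \<Rightarrow> 'a \<Rightarrow> 'a" where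
  "F x y z = (x \<cdot> y) \<bbslash> (x \<cdot> (y \<cdot> z))"

lemma F_hom:
  assumes "x \<in> Q" "y \<in> Q"
  shows "hom (F x y)"
proof (rule inner_hom)
  show "Linv Q m (x \<cdot> y) \<circ> (Lmap Q m x \<circ> (Lmap Q m y \<circ> id)) \<in> mlt_group Q m"
    using assms by (intro mlt_group.intros) auto
qed (use assms in \<open>auto simp: Linv_def Lmap_def F_def ldiv_eq_iff simp flip: ldiv_def\<close>)

lemmas T_in [simp] = hom_in[OF T_hom]
  and T_mult = hom_mult[OF T_hom]
  and T_ldiv = hom_ldiv[OF T_hom]
  and T_e = hom_e[OF T_hom]

lemmas F_in [simp] = hom_in[OF F_hom]
  and F_mult = hom_mult[OF F_hom]
  and F_ldiv = hom_ldiv[OF F_hom]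

lemma mult_T: "\<lbrakk>x \<in> Q; y \<in> Q\<rbrakk> \<Longrightarrow> x \<cdot> T x y = y \<cdot> x"
  by (simp add: T_def)

lemma T_self: "x \<in> Q \<Longrightarrow> T x x = x"
  by (simp add: T_def)

text \<open>Since \<open>T x\<close> is multiplicative and fixes \<open>x\<close>, the term
  \<open>x \<cdot> T x (x \<cdot> y)\<close> can be evaluated factor by factor or directly by
  \<open>mult_T\<close>.\<close>

lemma flexible:
  assumes "x \<in> Q" "y \<in> Q"
  shows "x \<cdot> (y \<cdot> x) = x \<cdot> y \<cdot> x"
proof -
  have "x \<cdot> (y \<cdot> x) = x \<cdot> T x (x \<cdot> y)"
    using assms by (simp add: T_mult T_self mult_T)
  also have "\<dots> = x \<cdot> y \<cdot> x"
    using assms by (simp add: mult_T)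
  finally show ?thesis .
qed

text \<open>By flexibility, left and right multiplication by \<open>x\<close> commute, so right
  multiplication by \<open>x\<close> commutes with left division by \<open>x\<close>.\<close>

lemma T_alt: "\<lbrakk>x \<in> Q; y \<in> Q\<rbrakk> \<Longrightarrow> T x y = (x \<bbslash> y) \<cdot> x"
  by (simp add: T_def ldiv_eq_iff flexible)

lemma T_eq_iff: "\<lbrakk>x \<in> Q; y \<in> Q; z \<in> Q\<rbrakk> \<Longrightarrow> T x y = z \<longleftrightarrow> y \<cdot> x = x \<cdot> z"
  by (simp add: T_def ldiv_eq_iff)

section \<open>Inverses\<close>

definition inv :: "'a \<Rightarrow> 'a" where
  "inv x = x \<bbslash> e"

lemma inv_in [simp]: "x \<in> Q \<Longrightarrow> inv x \<in> Q"
  and mult_inv [simp]: "x \<in> Q \<Longrightarrow> x \<cdot> inv x = e"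
  by (simp_all add: inv_def)

lemma inv_mult [simp]:
  assumes "x \<in> Q"
  shows "inv x \<cdot> x = e"
proof -
  \<comment> \<open>\<open>T x\<close> fixes \<open>x\<close> and \<open>e\<close>, hence also
    \<open>x \<bbslash> e\<close>; its fixed points are the elements commuting with
    \<open>x\<close>.\<close>
  have "T x (inv x) = inv x"
    using assms by (simp add: inv_def T_ldiv T_self T_e)
  then show ?thesis
    using assms by (simp add: T_eq_iff)
qed

lemma inv_inv [simp]: "x \<in> Q \<Longrightarrow> inv (inv x) = x"
  using mult_left_cancel[of "inv x" "inv (inv x)" x] by simp

lemma hom_inv: "\<lbrakk>hom \<phi>; x \<in> Q\<rbrakk> \<Longrightarrow> \<phi> (inv x) = inv (\<phi> x)"
  by (simp add: inv_def hom_ldiv hom_e)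

lemma F_self:
  "\<lbrakk>x \<in> Q; y \<in> Q\<rbrakk> \<Longrightarrow> F x y x = x"
  by (simp add: F_def flexible)

lemma F_inv:
  "\<lbrakk>x \<in> Q; y \<in> Q\<rbrakk> \<Longrightarrow> F x y (inv y) = (x \<cdot> y) \<bbslash> x"
  by (simp add: F_def)

lemma F_second:
  assumes "x \<in> Q" "y \<in> Q"
  shows "F x y y = inv ((x \<cdot> y) \<bbslash> x)"
  using hom_inv[OF F_hom, of x y "inv y"] F_inv[of x y] assms by simp

text \<open>With \<open>x = s \<cdot> v\<close> and \<open>y\<close> chosen so that
  \<open>x \<cdot> y = s\<close>, the mapping \<open>F x y\<close> fixes \<open>x\<close> and sends
  \<open>y\<close> to \<open>inv v\<close>. Its value at \<open>y \<bbslash> inv x\<close> is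
  computed once from the formula and once by multiplicativity.\<close>

lemma inv_mult_distrib:
  assumes "s \<in> Q" "v \<in> Q"
  shows "inv (s \<cdot> v) = inv v \<cdot> inv s"
proof -
  define x where "x = s \<cdot> v"
  define y where "y = x \<bbslash> s"
  have in_Q: "x \<in> Q" "y \<in> Q" and s: "x \<cdot> y = s"
    using assms by (simp_all add: x_def y_def)
  have "F x y (y \<bbslash> inv x) = inv s"
    using in_Q s by (simp add: F_def inv_def)
  moreover have "F x y (y \<bbslash> inv x) = inv v \<bbslash> inv x"
    using in_Q s assms
    by (simp add: F_ldiv F_second F_self hom_inv[OF F_hom]) (simp add: x_def)
  ultimately show ?thesis
    using assms by (simp add: ldiv_eq_iff x_def)
qed

text \<open>With \<open>y = x \<bbslash> s\<close> this is conjugation of the left multiplication \<open>L y\<close> by the automorphism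
  \<open>F x y\<close>, which sends \<open>y\<close> to \<open>inv v\<close>.\<close>
lemma F_ldiv_eq:
  assumes "s \<in> Q" "v \<in> Q" "z \<in> Q"
  defines "x \<equiv> s \<cdot> v"
  shows "inv v \<cdot> (s \<bbslash> z) = F x (x \<bbslash> s) (x \<bbslash> z)"
proof -
  define y where "y = x \<bbslash> s"
  have in_Q: "x \<in> Q" "y \<in> Q" and s: "x \<cdot> y = s" and v: "s \<bbslash> x = v"
    using assms by (simp_all add: x_def y_def)
  have "F x y (x \<bbslash> z) = F x y y \<cdot> F x y (y \<bbslash> (x \<bbslash> z))"
    using F_mult[of x y y "y \<bbslash> (x \<bbslash> z)"] in_Q assms by simp
  also have "F x y y = inv v"
    using in_Q s v by (simp add: F_second)
  also have "F x y (y \<bbslash> (x \<bbslash> z)) = s \<bbslash> z"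
    using in_Q assms s by (simp add: F_def)
  finally show ?thesis by (simp add: y_def)
qed

text \<open>By \<open>F_ldiv_eq\<close> the map from \<open>z\<close> to
  \<open>inv v \<cdot> (s \<bbslash> z)\<close> is left division by \<open>s \<cdot> v\<close>
  followed by an endomorphism fixing \<open>s \<cdot> v\<close>. Both commute with right
  multiplication by \<open>s \<cdot> v\<close>.\<close>

lemma commute_right:
  assumes "s \<in> Q" "v \<in> Q" "z \<in> Q"
  shows "inv v \<cdot> (s \<bbslash> (z \<cdot> (s \<cdot> v))) = inv v \<cdot> (s \<bbslash> z) \<cdot> (s \<cdot> v)"
proof -
  let ?x = "s \<cdot> v"
  have "?x \<bbslash> (z \<cdot> ?x) = (?x \<bbslash> z) \<cdot> ?x"
    using assms T_alt[of ?x z] by (simp add: T_def)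
  then show ?thesis
    using assms by (simp add: F_ldiv_eq F_mult F_self)
qed

section \<open>Commutators and their inverses\<close>

lemma inv_commutator:
  assumes "x \<in> Q" "y \<in> Q"
  shows "inv (y \<bbslash> T x y) = x \<bbslash> T y x"
proof -
  let ?c = "y \<bbslash> T x y" and ?w = "inv (y \<bbslash> x)" and ?f = "F x (x \<bbslash> y)"
  \<comment> \<open>\<open>F_ldiv_eq\<close> applies with product
    \<open>y \<cdot> (y \<bbslash> x) = x\<close>; \<open>?f\<close> fixes \<open>x\<close> and
    sends \<open>x \<bbslash> y\<close> to \<open>?w\<close>.\<close>
  have "?w \<cdot> ?c = ?f (x \<bbslash> T x y)"
    using assms F_ldiv_eq[of y "y \<bbslash> x" "T x y"] by simp
  also have "\<dots> = x \<bbslash> (?f (x \<bbslash> y) \<cdot> x)"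
    using assms by (simp add: F_ldiv F_mult F_self T_alt)
  also have "\<dots> = T x ?w"
    using assms by (simp add: F_second T_def)
  finally have "inv (?w \<cdot> ?c) = inv (T x ?w)"
    by simp
  then have *: "inv ?c \<cdot> (y \<bbslash> x) = T x (y \<bbslash> x)"
    using assms hom_inv[OF T_hom, of x ?w] by (simp add: inv_mult_distrib)
  \<comment> \<open>Here \<open>y \<cdot> ?c = T x y\<close>, and
    \<open>y \<bbslash> (x \<cdot> T x y)\<close> is just \<open>x\<close>.\<close>
  have "inv ?c \<cdot> x = inv ?c \<cdot> (y \<bbslash> x) \<cdot> T x y"
    using assms commute_right[of y ?c x] by (simp add: mult_T)
  also have "\<dots> = T x (T y x)"
    using assms by (simp add: * T_alt[of y x] T_mult)
  also have "\<dots> = (x \<bbslash> T y x) \<cdot> x"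
    using assms by (simp add: T_alt)
  finally show ?thesis
    using assms by simp
qed

text \<open>Inverting both sides of \<open>x \<cdot> T x (inv y) = inv y \<cdot> x\<close> reverses
  the products and gives the defining equation of \<open>T (inv x)\<close>.\<close>

lemma T_inv:
  assumes "x \<in> Q" "y \<in> Q"
  shows "T (inv x) (T x y) = y"
proof -
  have "inv (x \<cdot> T x (inv y)) = inv (inv y \<cdot> x)"
    using assms by (simp add: mult_T)
  then show ?thesis
    using assms by (simp add: T_eq_iff inv_mult_distrib hom_inv[OF T_hom])
qed

text \<open>Apply \<open>inv_commutator\<close> to \<open>inv x\<close> and \<open>y\<close>, then
  carry the result over by \<open>T x\<close>, which undoes \<open>T (inv x)\<close>.\<close>

lemma commutator_swap:
  assumes "x \<in> Q" "y \<in> Q"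
  shows "T x y \<bbslash> y = x \<bbslash> T y x"
proof -
  define z where "z = T y x"
  define w where "w = inv x \<bbslash> inv z"
  have in_Q: "z \<in> Q" "w \<in> Q"
    using assms by (simp_all add: z_def w_def)
  have "inv (inv x \<cdot> w) = inv (inv z)"
    using assms in_Q by (simp add: w_def)
  then have z: "inv w \<cdot> x = z"
    using assms in_Q by (simp add: inv_mult_distrib)
  have "inv (y \<bbslash> T (inv x) y) = w"
    using assms inv_commutator[of "inv x" y] by (simp add: w_def z_def hom_inv[OF T_hom])
  then have "y \<bbslash> T (inv x) y = inv w"
    using assms by (metis T_in inv_in inv_inv ldiv_in)
  then have "T x (y \<bbslash> T (inv x) y) = T x (inv w)"
    by simp
  then have "T x y \<bbslash> y = T x (inv w)"
    using assms T_inv[of "inv x" y] by (simp add: T_ldiv)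
  then show ?thesis
    using z by (simp add: T_def z_def)
qed

section \<open>Squares of products\<close>

lemma mult_inv_inv:
  assumes "x \<in> Q" "y \<in> Q"
  shows "x \<cdot> (inv x \<cdot> y) = y \<cdot> x \<cdot> inv x"
proof -
  \<comment> \<open>As \<open>x \<cdot> inv x = e\<close>, this endomorphism is \<open>z\<close> to
    \<open>x \<cdot> (inv x \<cdot> z)\<close>; it commutes with inversion, which reverses
    products.\<close>
  have "F x (inv x) (inv y) = inv (F x (inv x) y)"
    using assms by (simp add: hom_inv[OF F_hom])
  then have "inv (x \<cdot> (inv x \<cdot> inv y)) = x \<cdot> (inv x \<cdot> y)"
    using assms by (simp add: F_def)
  then show ?thesis
    using assms by (simp add: inv_mult_distrib)
qed

text \<open>After left division by \<open>x\<close>, both sides have the same image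
  \<open>v \<bbslash> (x \<cdot> inv v)\<close> under \<open>F x y\<close>, which is injective on
  \<open>Q\<close>.\<close>

lemma square_mult:
  assumes "x \<in> Q" "y \<in> Q"
  shows "x \<cdot> y \<cdot> (x \<cdot> y) = x \<cdot> (inv y \<bbslash> (x \<cdot> y))"
proof -
  define s where "s = x \<cdot> y"
  define v where "v = s \<bbslash> x"
  let ?f = "F x y"
  have in_Q: "s \<in> Q" "v \<in> Q" and x: "s \<cdot> v = x" and y: "x \<bbslash> s = y"
    using assms by (simp_all add: s_def v_def)
  have "?f (x \<bbslash> (s \<cdot> s)) = inv v \<cdot> s"
    using F_ldiv_eq[of s v "s \<cdot> s"] in_Q x y by simp
  also have "inv v \<cdot> s = v \<bbslash> (x \<cdot> inv v)"
    using mult_inv_inv[of v s] in_Q x by (metis inv_in ldiv_mult mult_in)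
  also have "\<dots> = ?f (inv y \<bbslash> s)"
    using assms in_Q
    by (simp add: s_def F_ldiv F_mult F_self F_second F_inv) (simp add: v_def s_def)
  finally have "y \<cdot> (x \<bbslash> (s \<cdot> s)) = y \<cdot> (inv y \<bbslash> s)"
    using assms in_Q by (simp add: F_def)
  then have "s \<cdot> s = x \<cdot> (inv y \<bbslash> s)"
    using assms in_Q by (simp add: ldiv_eq_iff)
  then show ?thesis by (simp add: s_def)
qed

section \<open>The two commutation conditions\<close>

lemma comm_mult_mult_iff:
  assumes "x \<in> Q" "y \<in> Q"
  shows "x \<cdot> (x \<cdot> y) = y \<cdot> x \<cdot> x \<longleftrightarrow> T x (T x y) = y"
proof -
  have "y \<cdot> x \<cdot> x = x \<cdot> (x \<cdot> T x (T x y))"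
    using assms by (simp add: mult_T flexible)
  then show ?thesis
    using assms by auto
qed

lemma comm_square_iff:
  assumes "x \<in> Q" "y \<in> Q"
  shows "x \<cdot> x \<cdot> y = y \<cdot> (x \<cdot> x) \<longleftrightarrow> T x (T x y) = y"
proof -
  define c where "c = y \<bbslash> T x y"
  have c: "c \<in> Q" and inv_c: "inv c = T x y \<bbslash> y"
    using assms inv_commutator[of x y] commutator_swap[of x y] by (simp_all add: c_def)
  have Tyx: "T y x = x \<cdot> inv c"
    using assms inv_commutator[of x y] by (simp add: c_def)
  have "x \<cdot> x \<cdot> y = y \<cdot> (T y x \<cdot> T y x)"
    using assms by (metis T_mult mult_T mult_in)
  \<comment> \<open>\<open>square_mult\<close> is used with second factor \<open>inv c\<close>,
    whose inverse is \<open>c\<close>.\<close>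
  then have "x \<cdot> x \<cdot> y = y \<cdot> (x \<cdot> x) \<longleftrightarrow> x \<cdot> (c \<bbslash> (x \<cdot> inv c)) = x \<cdot> x"
    using assms c by (simp add: Tyx square_mult)
  also have "\<dots> \<longleftrightarrow> x \<cdot> inv c = x \<cdot> T x c"
    using assms c by (simp add: ldiv_eq_iff mult_T)
  also have "\<dots> \<longleftrightarrow> T x y \<bbslash> y = T x y \<bbslash> T x (T x y)"
    using assms c by (simp add: inv_c) (simp add: c_def T_ldiv)
  also have "\<dots> \<longleftrightarrow> T x (T x y) = y"
    using assms by auto
  finally show ?thesis .
qed

end

theorem theorem3p1:
  fixes Q :: "'a set" and m :: "'a \<Rightarrow> 'a \<Rightarrow> 'a" and e :: 'a
  assumes "automorphic_loop Q m e" and "x \<in> Q" and "y \<in> Q"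
  shows "m x (m x y) = m (m y x) x \<longleftrightarrow> m (m x x) y = m y (m x x)"
proof -
  interpret automorphic Q m e
    using assms(1) by unfold_locales
  show ?thesis
    using assms(2,3) by (simp add: comm_mult_mult_iff comm_square_iff)
qed

end
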